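(* Let $G$ be a finite simple connected diamond-free graph with $m$ edges and $t(G)$ triangles, suppose $G$ is not a complete graph, and suppose $t(G)\notin\{1,2,3,4\}$. Then \[\lambda_1^2(G)+\lambda_2^2(G) \le \sum_{e\in E(G)}2\left(1-\frac{1}{c(e)}\right).\]
   Context: The diamond is $K_4$ minus one edge; $G$ is diamond-free if it contains no diamond as a subgraph. $\lambda_1(G)\ge\lambda_2(G)$ are the two largest adjacency eigenvalues of $G$. For an edge $e$, $c(e)$ is the order of the largest clique of $G$ containing $e$. *)

theory Defs
  imports
    "HOL-Library.Multiset"
    "Graph_Theory.Graph_Theory"
    "Jordan_Normal_Form.Char_Poly"
begin

text \<open>
  A finite simple graph is a \<open>pair_graph\<close>: finite, loop-free, with a symmetric set of ordered
  pairs as arcs. An undirected edge is the two-element set of the ends of an arc, so that each pair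
  of mutually inverse arcs counts as one edge.
\<close>

definition edges :: "'a pair_pre_digraph \<Rightarrow> 'a set set" where
  "edges G = {{u, v} | u v. (u, v) \<in> parcs G}"

definition clique :: "'a pair_pre_digraph \<Rightarrow> 'a set \<Rightarrow> bool" where
  "clique G K \<longleftrightarrow> K \<subseteq> pverts G \<and> (\<forall>u\<in>K. \<forall>v\<in>K. u \<noteq> v \<longrightarrow> (u, v) \<in> parcs G)"

definition num_triangles :: "'a pair_pre_digraph \<Rightarrow> nat" where
  "num_triangles G = card {T. clique G T \<and> card T = 3}"

definition edge_clique_number :: "'a pair_pre_digraph \<Rightarrow> 'a set \<Rightarrow> nat" where
  "edge_clique_number G e = Max {card K | K. clique G K \<and> e \<subseteq> K}"

definition diamond :: "nat pair_pre_digraph" where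
  "diamond = \<lparr> pverts = {0, 1, 2, 3},
     parcs = {(u, v). u \<in> {0, 1, 2, 3} \<and> v \<in> {0, 1, 2, 3} \<and> u \<noteq> v} - {(2, 3), (3, 2)} \<rparr>"

text \<open>The subgraph need not be induced; in particular a diamond-free graph has no \<open>K\<^sub>4\<close>.\<close>

definition diamond_free :: "'a pair_pre_digraph \<Rightarrow> bool" where
  "diamond_free G \<longleftrightarrow>
     \<not> (\<exists>H :: 'a pair_pre_digraph. subgraph (with_proj H) (with_proj G) \<and>
           digraph_iso (with_proj H) (with_proj diamond))"

text \<open>
  Matrices are indexed by natural numbers, so the vertices are listed in an arbitrary order. A
  different order conjugates the matrix by a permutation matrix and leaves its characteristic
  polynomial unchanged.
\<close>

definition vertex_list :: "'a pair_pre_digraph \<Rightarrow> 'a list" where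
  "vertex_list G = (SOME vs. distinct vs \<and> set vs = pverts G)"

definition adjacency_matrix :: "'a pair_pre_digraph \<Rightarrow> real mat" where
  "adjacency_matrix G = (let vs = vertex_list G in
     mat (length vs) (length vs) (\<lambda>(i, j). if (vs ! i, vs ! j) \<in> parcs G then 1 else 0))"

text \<open>
  All eigenvalues in decreasing order, repeated according to multiplicity. The matrix is real
  symmetric, so its characteristic polynomial splits over the reals and the list has as many
  entries as the graph has vertices.
\<close>

definition adjacency_eigenvalues :: "'a pair_pre_digraph \<Rightarrow> real list" where
  "adjacency_eigenvalues G =
     rev (sorted_list_of_multiset (proots (char_poly (adjacency_matrix G))))"

text \<open>The index \<open>k\<close> of the \<open>k\<close>-th largest eigenvalue starts at 1.\<close>

definition adjacency_eigenvalue :: "nat \<Rightarrow> 'a pair_pre_digraph \<Rightarrow> real" where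
  "adjacency_eigenvalue k G = adjacency_eigenvalues G ! (k - 1)"

end

theory Submission
  imports Defs "HOL-Computational_Algebra.Fundamental_Theorem_Algebra"
begin

text \<open>
  In a diamond-free graph every edge lies in at most one triangle, so the right-hand side is
  \<open>m + t\<close> and \<open>m \<ge> 3 t\<close>. Suppose \<open>\<lambda>\<^sub>1\<^sup>2 + \<lambda>\<^sub>2\<^sup>2 > m + t\<close>. Since the squares of all eigenvalues sum
  to \<open>2 m\<close>, the numbers \<open>\<bar>\<lambda>\<^sub>i\<bar>\<close> for \<open>i \<ge> 3\<close> together with \<open>sqrt (2 t)\<close> have squares summing to
  less than \<open>\<lambda>\<^sub>1\<^sup>2 + \<lambda>\<^sub>2\<^sup>2\<close>, and they all lie in \<open>[0, \<lambda>\<^sub>1]\<close>. By convexity of \<open>s powr (3/2)\<close> their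
  cubes sum to less than \<open>\<lambda>\<^sub>1\<^sup>3 + \<lambda>\<^sub>2\<^sup>3\<close>; here \<open>\<lambda>\<^sub>2 \<ge> 0\<close> because two vertices are not adjacent. As
  the cubes of all eigenvalues sum to \<open>6 t\<close>, this gives \<open>(2 t) powr (3/2) < 6 t\<close>, which forces
  \<open>1 \<le> t \<le> 4\<close>.
\<close>

section \<open>Sums of cubes under a bound on the sum of squares\<close>

lemma sum_list_cube_le:
  fixes w :: real
  assumes "\<And>z. z \<in> set zs \<Longrightarrow> 0 \<le> z \<and> z \<le> w"
  shows "(\<Sum>z\<leftarrow>zs. z ^ 3) \<le> w * (\<Sum>z\<leftarrow>zs. z\<^sup>2)"
  unfolding sum_list_const_mult[symmetric]
  by (rule sum_list_mono)
    (use assms in \<open>auto simp: power3_eq_cube power2_eq_square mult.assoc intro!: mult_right_mono\<close>)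

text \<open>The chord of \<open>s \<mapsto> s powr (3/2)\<close> over \<open>[M\<^sup>2, L\<^sup>2]\<close> lies above the graph.\<close>

lemma cube_le_chord:
  fixes L M x :: real
  assumes "0 \<le> M" "M \<le> x" "x \<le> L"
  shows "(L + M) * (x ^ 3 - M ^ 3) \<le> (L\<^sup>2 + L * M + M\<^sup>2) * (x\<^sup>2 - M\<^sup>2)"
proof -
  \<comment> \<open>The chord has slope \<open>(L^2 + L*M + M^2) / (L + M)\<close>, cross-multiplied
    here. The gap vanishes at \<open>x = M\<close> and \<open>x = L\<close>, which gives the two
    linear factors.\<close>
  have "(L\<^sup>2 + L * M + M\<^sup>2) * (x\<^sup>2 - M\<^sup>2) - (L + M) * (x ^ 3 - M ^ 3)
    = (x - M) * ((L - x) * (L * x + L * M + M * x))"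
    by (simp add: algebra_simps power2_eq_square power3_eq_cube)
  also have "\<dots> \<ge> 0"
    using assms by (intro mult_nonneg_nonneg add_nonneg_nonneg) auto
  finally show ?thesis by simp
qed

text \<open>The chord bound is affine in the square and exact at \<open>M\<close> and
  \<open>L\<close>. Added up for \<open>x\<close> and \<open>y\<close>, it depends only on
  \<open>x^2 + y^2\<close>, so it takes the same value as for the pair \<open>L\<close>,
  \<open>M\<close>.\<close>

lemma sum_cubes_le_of_sum_squares:
  fixes L M x y :: real
  assumes "0 \<le> M" "0 < L" "M \<le> x" "x \<le> L" "M \<le> y" "y \<le> L" "x\<^sup>2 + y\<^sup>2 = L\<^sup>2 + M\<^sup>2"
  shows "x ^ 3 + y ^ 3 \<le> L ^ 3 + M ^ 3"
proof -
  have "(L + M) * (x ^ 3 - M ^ 3) + (L + M) * (y ^ 3 - M ^ 3)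
      \<le> (L\<^sup>2 + L * M + M\<^sup>2) * (x\<^sup>2 - M\<^sup>2) + (L\<^sup>2 + L * M + M\<^sup>2) * (y\<^sup>2 - M\<^sup>2)"
    using assms by (intro add_mono cube_le_chord) auto
  also have "\<dots> = (L\<^sup>2 + L * M + M\<^sup>2) * ((x\<^sup>2 + y\<^sup>2) - 2 * M\<^sup>2)"
    by (simp add: algebra_simps)
  also have "\<dots> = (L + M) * (L ^ 3 - M ^ 3)"
    unfolding assms(7) by (simp add: algebra_simps power2_eq_square power3_eq_cube)
  finally have "(L + M) * (x ^ 3 + y ^ 3) \<le> (L + M) * (L ^ 3 + M ^ 3)"
    by (simp add: algebra_simps)
  then show ?thesis using assms by simp
qed

text \<open>If no entry exceeds \<open>M\<close>, the cubes sum to at most \<open>M\<close> times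
  the squares. Otherwise an entry \<open>x > M\<close> is split off, the other squares sum to less
  than some \<open>w^2\<close> and hence their cubes to less than \<open>w^3\<close>, and the
  two-term inequality handles \<open>x\<close> and \<open>w\<close>.\<close>

lemma sum_list_cubes_less:
  fixes L M :: real
  assumes zs: "\<And>z. z \<in> set zs \<Longrightarrow> 0 \<le> z \<and> z \<le> L"
    and "0 \<le> M" "M \<le> L" "0 < L"
    and less: "(\<Sum>z\<leftarrow>zs. z\<^sup>2) < L\<^sup>2 + M\<^sup>2"
  shows "(\<Sum>z\<leftarrow>zs. z ^ 3) < L ^ 3 + M ^ 3"
proof (cases "\<forall>z\<in>set zs. z \<le> M")
  case True
  have le: "(\<Sum>z\<leftarrow>zs. z ^ 3) \<le> M * (\<Sum>z\<leftarrow>zs. z\<^sup>2)"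
    using True zs by (intro sum_list_cube_le) auto
  \<comment> \<open>Multiplying the strict bound by \<open>M\<close> keeps it strict only for
    nonzero \<open>M\<close>; for \<open>M = 0\<close> the cubes sum to at most 0.\<close>
  show ?thesis
  proof (cases "M = 0")
    case True
    then show ?thesis using le \<open>0 < L\<close> by (simp add: order_le_less_trans)
  next
    case False
    have "M * (\<Sum>z\<leftarrow>zs. z\<^sup>2) < M * (L\<^sup>2 + M\<^sup>2)"
      using False assms by (intro mult_strict_left_mono) auto
    also have "\<dots> = M * L\<^sup>2 + M ^ 3"
      by (simp add: algebra_simps power2_eq_square power3_eq_cube)
    also have "\<dots> \<le> L * L\<^sup>2 + M ^ 3"
      using assms by (intro add_right_mono mult_right_mono) auto
    finally show ?thesis using le by (simp add: power2_eq_square power3_eq_cube)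
  qed
next
  case False
  then obtain x where x: "x \<in> set zs" "x > M" by auto
  then obtain ys ys' where zs_eq: "zs = ys @ x # ys'" by (meson split_list)
  define us where "us = ys @ ys'"
  \<comment> \<open>\<open>w\<close> completes \<open>x\<close> to a pair whose squares sum to
    exactly \<open>L^2 + M^2\<close>; it lies in \<open>[M, L]\<close> because \<open>x\<close>
    does.\<close>
  define w where "w = sqrt (L\<^sup>2 + M\<^sup>2 - x\<^sup>2)"
  have "x \<le> L" using zs x by auto
  then have xL: "x\<^sup>2 \<le> L\<^sup>2" and xM: "M\<^sup>2 \<le> x\<^sup>2"
    using x \<open>0 \<le> M\<close> by (auto intro!: power_mono)
  have w2: "w\<^sup>2 = L\<^sup>2 + M\<^sup>2 - x\<^sup>2" and "0 \<le> w"
    using xL by (auto simp: w_def add_increasing2)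
  have "M \<le> w"
    unfolding w_def using xL by (intro real_le_rsqrt) auto
  have "w \<le> L"
    unfolding w_def using xM \<open>0 < L\<close> by (intro real_le_lsqrt) auto
  have us_less: "(\<Sum>z\<leftarrow>us. z\<^sup>2) < w\<^sup>2"
    using less unfolding w2 zs_eq us_def by simp
  have "0 \<le> (\<Sum>z\<leftarrow>us. z\<^sup>2)"
    by (intro sum_list_nonneg) auto
  with us_less \<open>0 \<le> w\<close> have "0 < w"
    by (cases "w = 0") auto
  have "z \<le> w" if "z \<in> set us" for z
  proof -
    have "z\<^sup>2 \<le> (\<Sum>z\<leftarrow>us. z\<^sup>2)"
      using that by (intro member_le_sum_list) auto
    then show ?thesis
      using us_less \<open>0 \<le> w\<close> by (auto intro: power2_le_imp_le[of z w])
  qed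
  then have "(\<Sum>z\<leftarrow>us. z ^ 3) \<le> w * (\<Sum>z\<leftarrow>us. z\<^sup>2)"
    using zs by (intro sum_list_cube_le) (auto simp: us_def zs_eq)
  also have "\<dots> < w * w\<^sup>2"
    using us_less \<open>0 < w\<close> by (intro mult_strict_left_mono)
  finally have "(\<Sum>z\<leftarrow>us. z ^ 3) < w ^ 3"
    by (simp add: power2_eq_square power3_eq_cube)
  moreover have "x ^ 3 + w ^ 3 \<le> L ^ 3 + M ^ 3"
    using assms(2,4) x(2) \<open>x \<le> L\<close> \<open>M \<le> w\<close> \<open>w \<le> L\<close> w2 by (intro sum_cubes_le_of_sum_squares) auto
  ultimately show ?thesis
    by (simp add: zs_eq us_def)
qed

section \<open>Spectral decomposition of real symmetric matrices\<close>

text \<open>The characteristic polynomial has a complex root \<open>c\<close>. For an eigenvector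
  \<open>z\<close>, the Hermitian form of \<open>A\<close> at \<open>z\<close> equals
  \<open>c\<close> times the squared norm of \<open>z\<close> and is its own conjugate, so
  \<open>c\<close> is real.\<close>

lemma real_symmetric_eigenvalue_exists:
  fixes A :: "real mat"
  assumes A: "A \<in> carrier_mat n n" and sym: "A\<^sup>T = A" and "0 < n"
  shows "\<exists>e. eigenvalue A e"
proof -
  interpret of_real_hom: inj_comm_ring_hom "of_real :: real \<Rightarrow> complex"
    by standard auto
  interpret of_real_poly: map_poly_inj_comm_ring_hom "of_real :: real \<Rightarrow> complex" ..
  define B :: "complex mat" where "B = map_mat of_real A"
  have B: "B \<in> carrier_mat n n" using A by (simp add: B_def)
  have Aij: "A $$ (i, j) = A $$ (j, i)" if "i < n" "j < n" for i j
    using that A by (subst sym[symmetric]) auto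
  have "degree (char_poly B) = n" using degree_monic_char_poly[OF B] by simp
  then have "\<not> constant (poly (char_poly B))"
    using \<open>0 < n\<close> by (simp add: constant_degree)
  then obtain c where c: "poly (char_poly B) c = 0"
    using fundamental_theorem_of_algebra by blast
  then obtain z where z: "z \<in> carrier_vec n" "z \<noteq> 0\<^sub>v n" "B *\<^sub>v z = c \<cdot>\<^sub>v z"
    using eigenvalue_root_char_poly[OF B] B by (auto simp: eigenvalue_def eigenvector_def)
  define N where "N = (\<Sum>i<n. (cmod (z $ i))\<^sup>2)"
  define S where "S = (\<Sum>i<n. \<Sum>j<n. cnj (z $ i) * complex_of_real (A $$ (i, j)) * z $ j)"
  have row: "(\<Sum>j<n. of_real (A $$ (i, j)) * z $ j) = c * z $ i" if "i < n" for i
  proof -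
    have "(B *\<^sub>v z) $ i = c * z $ i" using that z by simp
    then show ?thesis using that A z(1)
      by (simp add: B_def mult_mat_vec_def scalar_prod_def atLeast0LessThan)
  qed
  have "S = (\<Sum>i<n. cnj (z $ i) * (\<Sum>j<n. of_real (A $$ (i, j)) * z $ j))"
    by (simp add: S_def sum_distrib_left mult.assoc)
  also have "\<dots> = (\<Sum>i<n. c * of_real ((cmod (z $ i))\<^sup>2))"
    by (rule sum.cong) (auto simp: row complex_norm_square simp del: of_real_power)
  also have "\<dots> = c * of_real N"
    by (simp add: N_def sum_distrib_left)
  finally have S: "S = c * of_real N" .
  \<comment> \<open>Conjugation exchanges the roles of \<open>i\<close> and \<open>j\<close>, since
    \<open>A\<close> is real and symmetric.\<close>
  have "cnj S = (\<Sum>i<n. \<Sum>j<n. cnj (z $ j) * complex_of_real (A $$ (j, i)) * z $ i)"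
    by (auto simp: S_def Aij intro!: sum.cong)
  also have "\<dots> = S"
    unfolding S_def by (rule sum.swap)
  finally have "cnj S = S" .
  have "\<exists>i<n. z $ i \<noteq> 0"
    using z(1,2) by (metis eq_vecI carrier_vecD index_zero_vec)
  then have "N > 0"
    unfolding N_def by (auto intro: sum_pos2)
  with \<open>cnj S = S\<close> S have "cnj c = c" by simp
  then obtain e where e: "c = of_real e" by (metis Reals_cases Reals_cnj_iff)
  have "poly (map_poly of_real (char_poly A)) (complex_of_real e) = 0"
    using c unfolding e B_def of_real_hom.char_poly_hom[OF A] .
  then have "poly (char_poly A) e = 0" by simp
  then show ?thesis using eigenvalue_root_char_poly[OF A] by blast
qed

text \<open>
  The Householder reflection exchanging the unit vector \<open>v\<close> with the first standard basis vector;
  division by zero makes it the identity if they coincide.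
\<close>

lemma householder_exists:
  fixes v :: "real vec"
  assumes v: "v \<in> carrier_vec (Suc n)" and unit: "v \<bullet> v = 1"
  shows "\<exists>W \<in> carrier_mat (Suc n) (Suc n). W\<^sup>T = W \<and> W * W = 1\<^sub>m (Suc n) \<and> col W 0 = v"
proof -
  define w where "w i = v $ i - (if i = 0 then 1 else 0)" for i
  define N where "N = (\<Sum>i<Suc n. (w i)\<^sup>2)"
  define c where "c = 2 / N"
  define W where "W = mat (Suc n) (Suc n) (\<lambda>(i, j). (if i = j then 1 else 0) - c * w i * w j)"
  have W: "W \<in> carrier_mat (Suc n) (Suc n)" by (simp add: W_def)
  \<comment> \<open>This holds for \<open>N = 0\<close> too, where \<open>c = 0\<close>.\<close>
  have ccN: "c * c * N = 2 * c" by (simp add: c_def)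
  have "(W * W) $$ (i, k) = 1\<^sub>m (Suc n) $$ (i, k)" if "i < Suc n" "k < Suc n" for i k
  proof -
    have "(W * W) $$ (i, k) = (\<Sum>j<Suc n. ((if i = j then 1 else 0) - c * w i * w j) *
        ((if j = k then 1 else 0) - c * w j * w k))"
      using that by (simp add: W_def scalar_prod_def atLeast0LessThan del: sum.lessThan_Suc)
    also have "\<dots> = (\<Sum>j<Suc n. (if j = i then if i = k then 1 else 0 else 0)
        - (if j = i then c * w i * w k else 0) - (if j = k then c * w i * w k else 0)
        + c * c * w i * w k * (w j)\<^sup>2)"
      by (rule sum.cong) (auto simp: algebra_simps power2_eq_square)
    also have "\<dots> = (if i = k then 1 else 0) - c * w i * w k - c * w i * w k + c * c * w i * w k * N"
      using that
      by (simp add: sum.distrib sum_subtractf N_def sum_distrib_left del: sum.lessThan_Suc)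
    also have "c * c * w i * w k * N = 2 * c * w i * w k"
      using ccN by (metis mult.assoc mult.commute)
    finally show ?thesis using that by simp
  qed
  then have WW: "W * W = 1\<^sub>m (Suc n)" using W by (intro eq_matI) auto
  have "v \<bullet> v = (\<Sum>i<Suc n. (v $ i)\<^sup>2)"
    using v by (simp add: scalar_prod_def atLeast0LessThan power2_eq_square del: sum.lessThan_Suc)
  then have v2: "(\<Sum>i<Suc n. (v $ i)\<^sup>2) = 1" using unit by simp
  \<comment> \<open>For the unit vector \<open>v\<close>, the squared distance \<open>N\<close> to
    the first basis vector is \<open>2 - 2 * v $ 0\<close>.\<close>
  have "N = (\<Sum>i<Suc n. (v $ i)\<^sup>2 + (if i = 0 then 1 - 2 * v $ i else 0))"
    unfolding N_def w_def by (rule sum.cong) (auto simp: power2_eq_square algebra_simps)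
  also have "\<dots> = - 2 * w 0"
    unfolding sum.distrib v2 by (simp add: w_def del: sum.lessThan_Suc)
  finally have N: "N = - 2 * w 0" .
  have "W $$ (i, 0) = v $ i" if "i < Suc n" for i
  proof (cases "N = 0")
    case True
    then have "\<forall>i<Suc n. w i = 0"
      unfolding N_def by (subst (asm) sum_nonneg_eq_0_iff) auto
    then show ?thesis using that True by (auto simp: W_def c_def w_def)
  next
    case False
    then have "c * w 0 = - 1" unfolding c_def N by (simp add: field_simps)
    then have "c * w i * w 0 = - w i"
      by (metis mult.assoc mult.commute mult_minus1)
    then show ?thesis using that by (auto simp: W_def w_def)
  qed
  then have "col W 0 = v" using W v by (intro eq_vecI) auto
  moreover have "W\<^sup>T = W"
    by (rule eq_matI) (auto simp: W_def)
  ultimately show ?thesis using W WW by blast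
qed

text \<open>Induction by deflation: a reflection moves a unit eigenvector to the first basis vector.
  The reflected matrix is symmetric and its first column is a multiple of that basis vector, so it
  splits into a \<open>1 x 1\<close> block and a smaller symmetric block.\<close>

theorem real_symmetric_diagonalization:
  fixes A :: "real mat"
  assumes "A \<in> carrier_mat n n" "A\<^sup>T = A"
  shows "\<exists>P \<in> carrier_mat n n. \<exists>D \<in> carrier_mat n n.
    P\<^sup>T * P = 1\<^sub>m n \<and> P * P\<^sup>T = 1\<^sub>m n \<and> diagonal_mat D \<and> A = P * D * P\<^sup>T"
  using assms
proof (induction n arbitrary: A)
  case 0
  then show ?case
    by (intro bexI[of _ "1\<^sub>m 0"] bexI[of _ "0\<^sub>m 0 0"]) (auto simp: diagonal_mat_def)
next
  case (Suc n)
  note A = Suc.prems(1) and sym = Suc.prems(2)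
  obtain e u where u: "u \<in> carrier_vec (Suc n)" "u \<noteq> 0\<^sub>v (Suc n)" "A *\<^sub>v u = e \<cdot>\<^sub>v u"
    using real_symmetric_eigenvalue_exists[OF A sym] A
    by (auto simp: eigenvalue_def eigenvector_def)
  have uu: "u \<bullet> u > 0"
    using conjugate_square_greater_0_vec[OF u(1)] u(2) by simp
  define v where "v = (1 / sqrt (u \<bullet> u)) \<cdot>\<^sub>v u"
  have v: "v \<in> carrier_vec (Suc n)" using u by (simp add: v_def)
  have "v \<bullet> v = 1"
    using uu u by (simp add: v_def)
  have Av: "A *\<^sub>v v = e \<cdot>\<^sub>v v"
    using u A by (simp add: v_def mult_mat_vec smult_smult_assoc mult.commute)
  from householder_exists[OF v \<open>v \<bullet> v = 1\<close>] obtain W where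
    W: "W \<in> carrier_mat (Suc n) (Suc n)" and WT: "W\<^sup>T = W" and WW: "W * W = 1\<^sub>m (Suc n)"
    and col: "col W 0 = v" by blast
  define B where "B = W * A * W"
  have B: "B \<in> carrier_mat (Suc n) (Suc n)" using W A by (simp add: B_def)
  have BT: "B\<^sup>T = B"
    using A W unfolding B_def
    by (simp add: transpose_mult[of _ "Suc n" "Suc n" _ "Suc n"] WT sym assoc_mult_mat[of _ "Suc n" "Suc n" _ "Suc n" _ "Suc n"])
  \<comment> \<open>Column 0 of \<open>W * A * W\<close> is \<open>W * A\<close> applied to
    \<open>v\<close>, thus \<open>e\<close> times \<open>W\<close> applied to its own column 0, and
    \<open>W\<close> is an involution.\<close>
  have "col B 0 = (W * A) *\<^sub>v v"
    unfolding B_def using W A col by (subst col_mult2[of _ "Suc n" "Suc n" _ "Suc n"]) auto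
  also have "\<dots> = W *\<^sub>v (e \<cdot>\<^sub>v v)"
    using W A v by (simp add: assoc_mult_mat_vec[of _ "Suc n" "Suc n" _ "Suc n"] Av)
  also have "\<dots> = e \<cdot>\<^sub>v (W *\<^sub>v col W 0)"
    using W v by (simp add: mult_mat_vec col)
  also have "W *\<^sub>v col W 0 = col (W * W) 0"
    using W by (subst col_mult2[of _ "Suc n" "Suc n" _ "Suc n"]) auto
  also have "\<dots> = unit_vec (Suc n) 0"
    unfolding WW by simp
  finally have colB: "col B 0 = e \<cdot>\<^sub>v unit_vec (Suc n) 0" .
  have B0: "B $$ (i, 0) = (if i = 0 then e else 0)" if "i < Suc n" for i
    using arg_cong[OF colB, of "\<lambda>x. x $ i"] that B by auto
  have Bsym: "B $$ (i, j) = B $$ (j, i)" if "i < Suc n" "j < Suc n" for i j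
    using that B by (subst BT[symmetric]) auto
  define A' where "A' = mat n n (\<lambda>(i, j). B $$ (Suc i, Suc j))"
  have A': "A' \<in> carrier_mat n n" "A'\<^sup>T = A'"
    unfolding A'_def by (auto simp: Bsym)
  define E where "E = mat 1 1 (\<lambda>_. e)"
  have E: "E \<in> carrier_mat 1 1" by (simp add: E_def)
  have B_eq: "B = four_block_mat E (0\<^sub>m 1 n) (0\<^sub>m n 1) A'"
    using B by (intro eq_matI) (auto simp: E_def A'_def B0 Bsym[of 0])
  from Suc.IH[OF A'] obtain P' D' where P': "P' \<in> carrier_mat n n" "D' \<in> carrier_mat n n"
    "P'\<^sup>T * P' = 1\<^sub>m n" "P' * P'\<^sup>T = 1\<^sub>m n" "diagonal_mat D'" "A' = P' * D' * P'\<^sup>T" by blast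
  define F where "F = four_block_mat (1\<^sub>m 1) (0\<^sub>m 1 n) (0\<^sub>m n 1) P'"
  define D where "D = four_block_mat E (0\<^sub>m 1 n) (0\<^sub>m n 1) D'"
  have F: "F \<in> carrier_mat (Suc n) (Suc n)" and D: "D \<in> carrier_mat (Suc n) (Suc n)"
    using P' E four_block_carrier_mat[of _ 1 1 _ n n] by (auto simp: F_def D_def)
  have FT: "F\<^sup>T = four_block_mat (1\<^sub>m 1) (0\<^sub>m 1 n) (0\<^sub>m n 1) P'\<^sup>T"
    unfolding F_def using P'(1) by (subst transpose_four_block_mat[of _ 1 1 _ n _ n]) auto
  have FF: "F\<^sup>T * F = 1\<^sub>m (Suc n)"
    unfolding FT unfolding F_def using P'(1,3)
    by (subst mult_four_block_mat[of _ 1 1 _ n _ n _ _ 1 _ n]) auto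
  have B_FDF: "B = F * D * F\<^sup>T"
    unfolding FT B_eq unfolding F_def D_def P'(6) using P'(1,2) E
    by (simp add: mult_four_block_mat[of _ 1 1 _ n _ n _ _ 1 _ n])
  have diag: "diagonal_mat D"
    using P'(2,5) by (auto simp: D_def E_def diagonal_mat_def)
  \<comment> \<open>The reflection is composed with the diagonalization of the smaller block, since
    \<open>A = W * B * W\<close> and \<open>B = F * D * F\<^sup>T\<close>.\<close>
  define P where "P = W * F"
  have P: "P \<in> carrier_mat (Suc n) (Suc n)" using W F by (simp add: P_def)
  have PT: "P\<^sup>T = F\<^sup>T * W" using W F by (simp add: P_def transpose_mult[of _ "Suc n" "Suc n"] WT)
  have FTc: "F\<^sup>T \<in> carrier_mat (Suc n) (Suc n)" using F by simp
  note assoc = assoc_mult_mat[of _ "Suc n" "Suc n" _ "Suc n" _ "Suc n"]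
  have "P\<^sup>T * P = F\<^sup>T * (W * W) * F"
    unfolding PT unfolding P_def using W F FTc by (simp add: assoc)
  then have PP: "P\<^sup>T * P = 1\<^sub>m (Suc n)" unfolding WW using F FTc FF by simp
  then have PP': "P * P\<^sup>T = 1\<^sub>m (Suc n)"
    using P by (intro mat_mult_left_right_inverse[of "P\<^sup>T"]) auto
  have "P * D * P\<^sup>T = W * (F * D * F\<^sup>T) * W"
    unfolding PT unfolding P_def using W F FTc D by (simp add: assoc)
  also have "\<dots> = (W * W) * A * (W * W)"
    unfolding B_FDF[symmetric] B_def using W A by (simp add: assoc)
  also have "\<dots> = A" unfolding WW using A by simp
  finally show ?case using P D PP PP' diag by metis
qed

section \<open>Traces and quadratic forms in an orthonormal eigenbasis\<close>

locale spectral_decomposition =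
  fixes n :: nat and A :: "nat \<Rightarrow> nat \<Rightarrow> real" and d :: "nat \<Rightarrow> real" and q :: "nat \<Rightarrow> nat \<Rightarrow> real"
  assumes orthonormal: "i < n \<Longrightarrow> j < n \<Longrightarrow> (\<Sum>a<n. q i a * q j a) = of_bool (i = j)"
    and complete: "a < n \<Longrightarrow> b < n \<Longrightarrow> (\<Sum>i<n. q i a * q i b) = of_bool (a = b)"
    and decomposition: "a < n \<Longrightarrow> b < n \<Longrightarrow> A a b = (\<Sum>i<n. d i * q i a * q i b)"
begin

text \<open>The functional calculus of \<open>A\<close>: the matrix with the same eigenvectors and
  eigenvalues \<open>e i\<close>.\<close>

definition spec :: "(nat \<Rightarrow> real) \<Rightarrow> nat \<Rightarrow> nat \<Rightarrow> real" where
  "spec e a b = (\<Sum>i<n. e i * q i a * q i b)"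

lemma eq_spec: "a < n \<Longrightarrow> b < n \<Longrightarrow> A a b = spec d a b"
  by (simp add: decomposition spec_def)

text \<open>Orthonormality kills the mixed terms, so matrix products become pointwise products of
  eigenvalues and power traces become power sums.\<close>

lemma spec_mult: "(\<Sum>b<n. spec e a b * spec f b c) = spec (\<lambda>i. e i * f i) a c"
proof -
  have "(\<Sum>b<n. spec e a b * spec f b c)
      = (\<Sum>b<n. \<Sum>i<n. \<Sum>j<n. e i * f j * q i a * q j c * (q i b * q j b))"
    unfolding spec_def sum_product by (intro sum.cong) (auto simp: algebra_simps)
  also have "\<dots> = (\<Sum>i<n. \<Sum>j<n. \<Sum>b<n. e i * f j * q i a * q j c * (q i b * q j b))"
    by (subst sum.swap, rule sum.cong[OF refl], rule sum.swap)
  also have "\<dots> = (\<Sum>i<n. \<Sum>j<n. e i * f j * q i a * q j c * of_bool (i = j))"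
    by (intro sum.cong) (auto simp: sum_distrib_left[symmetric] orthonormal)
  also have "\<dots> = (\<Sum>i<n. e i * f i * q i a * q i c)"
    by (intro sum.cong) (auto simp: of_bool_def if_distrib cong: if_cong)
  finally show ?thesis by (simp add: spec_def)
qed

lemma spec_trace: "(\<Sum>a<n. spec e a a) = (\<Sum>i<n. e i)"
proof -
  have "(\<Sum>a<n. spec e a a) = (\<Sum>i<n. \<Sum>a<n. e i * (q i a * q i a))"
    unfolding spec_def by (subst sum.swap) (simp add: mult.assoc)
  also have "\<dots> = (\<Sum>i<n. e i)"
    by (intro sum.cong) (auto simp: sum_distrib_left[symmetric] orthonormal)
  finally show ?thesis .
qed

lemma trace_square: "(\<Sum>a<n. \<Sum>b<n. A a b * A b a) = (\<Sum>i<n. (d i)\<^sup>2)"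
proof -
  have "(\<Sum>a<n. \<Sum>b<n. A a b * A b a) = (\<Sum>a<n. \<Sum>b<n. spec d a b * spec d b a)"
    by (intro sum.cong) (auto simp: eq_spec)
  then show ?thesis by (simp add: spec_mult spec_trace power2_eq_square)
qed

text \<open>For an adjacency matrix the left side counts closed walks of length three.\<close>

lemma trace_cube: "(\<Sum>a<n. \<Sum>b<n. \<Sum>c<n. A a b * A b c * A c a) = (\<Sum>i<n. d i ^ 3)"
proof -
  have "(\<Sum>a<n. \<Sum>b<n. \<Sum>c<n. A a b * A b c * A c a)
      = (\<Sum>a<n. \<Sum>b<n. spec d a b * (\<Sum>c<n. spec d b c * spec d c a))"
    by (intro sum.cong) (auto simp: eq_spec sum_distrib_left mult.assoc)
  then show ?thesis by (simp add: spec_mult spec_trace power3_eq_cube mult.assoc)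
qed

lemma quadratic_form:
  "(\<Sum>a<n. \<Sum>b<n. A a b * x a * x b) = (\<Sum>i<n. d i * (\<Sum>a<n. q i a * x a)\<^sup>2)"
proof -
  have "(\<Sum>a<n. \<Sum>b<n. A a b * x a * x b)
      = (\<Sum>a<n. \<Sum>b<n. \<Sum>i<n. d i * ((q i a * x a) * (q i b * x b)))"
    by (intro sum.cong) (auto simp: decomposition sum_distrib_left mult_ac)
  also have "\<dots> = (\<Sum>a<n. \<Sum>i<n. \<Sum>b<n. d i * ((q i a * x a) * (q i b * x b)))"
    by (rule sum.cong[OF refl], rule sum.swap)
  also have "\<dots> = (\<Sum>i<n. \<Sum>a<n. \<Sum>b<n. d i * ((q i a * x a) * (q i b * x b)))"
    by (rule sum.swap)
  also have "\<dots> = (\<Sum>i<n. d i * (\<Sum>a<n. q i a * x a)\<^sup>2)"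
    unfolding power2_eq_square sum_product unfolding sum_distrib_left ..
  finally show ?thesis .
qed

lemma parseval: "(\<Sum>i<n. (\<Sum>a<n. q i a * x a)\<^sup>2) = (\<Sum>a<n. (x a)\<^sup>2)"
proof -
  have "(\<Sum>i<n. (\<Sum>a<n. q i a * x a)\<^sup>2)
      = (\<Sum>i<n. \<Sum>a<n. \<Sum>b<n. x a * x b * (q i a * q i b))"
    unfolding power2_eq_square sum_product by (intro sum.cong) (auto simp: algebra_simps)
  also have "\<dots> = (\<Sum>a<n. \<Sum>b<n. \<Sum>i<n. x a * x b * (q i a * q i b))"
    by (subst sum.swap, rule sum.cong[OF refl], rule sum.swap)
  also have "\<dots> = (\<Sum>a<n. \<Sum>b<n. x a * x b * of_bool (a = b))"
    by (intro sum.cong) (auto simp: sum_distrib_left[symmetric] complete)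
  also have "\<dots> = (\<Sum>a<n. (x a)\<^sup>2)"
    by (intro sum.cong) (auto simp: of_bool_def power2_eq_square if_distrib cong: if_cong)
  finally show ?thesis .
qed

lemma rayleigh_le:
  assumes "\<And>i. i < n \<Longrightarrow> d i \<le> L"
  shows "(\<Sum>a<n. \<Sum>b<n. A a b * x a * x b) \<le> L * (\<Sum>a<n. (x a)\<^sup>2)"
proof -
  have "(\<Sum>a<n. \<Sum>b<n. A a b * x a * x b) \<le> (\<Sum>i<n. L * (\<Sum>a<n. q i a * x a)\<^sup>2)"
    unfolding quadratic_form using assms by (intro sum_mono mult_right_mono) auto
  also have "\<dots> = L * (\<Sum>a<n. (x a)\<^sup>2)"
    by (simp add: sum_distrib_left[symmetric] parseval)
  finally show ?thesis .
qed

lemma quadratic_form_eigenvector: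
  assumes "k < n"
  shows "(\<Sum>a<n. \<Sum>b<n. A a b * q k a * q k b) = d k"
proof -
  have "(\<Sum>a<n. \<Sum>b<n. A a b * q k a * q k b) = (\<Sum>i<n. if i = k then d i else 0)"
    unfolding quadratic_form using assms by (intro sum.cong) (auto simp: orthonormal)
  then show ?thesis using assms by simp
qed

text \<open>
  Replacing an eigenvector by its entrywise absolute value only increases the absolute value of
  the quadratic form.
\<close>

lemma nonneg_abs_eigenvalue_le:
  assumes nonneg: "\<And>a b. a < n \<Longrightarrow> b < n \<Longrightarrow> 0 \<le> A a b"
    and le: "\<And>i. i < n \<Longrightarrow> d i \<le> L" and k: "k < n"
  shows "\<bar>d k\<bar> \<le> L"
proof -
  have "\<bar>d k\<bar> \<le> (\<Sum>a<n. \<bar>\<Sum>b<n. A a b * q k a * q k b\<bar>)"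
    unfolding quadratic_form_eigenvector[OF k, symmetric] by (rule sum_abs)
  also have "\<dots> \<le> (\<Sum>a<n. \<Sum>b<n. \<bar>A a b * q k a * q k b\<bar>)"
    by (intro sum_mono sum_abs)
  also have "\<dots> = (\<Sum>a<n. \<Sum>b<n. A a b * \<bar>q k a\<bar> * \<bar>q k b\<bar>)"
    by (intro sum.cong) (auto simp: abs_mult nonneg)
  also have "\<dots> \<le> L * (\<Sum>a<n. \<bar>q k a\<bar>\<^sup>2)"
    using le by (rule rayleigh_le)
  also have "(\<Sum>a<n. \<bar>q k a\<bar>\<^sup>2) = 1"
    using orthonormal[OF k k] by (simp add: power2_eq_square)
  finally show ?thesis by simp
qed

text \<open>
  The vanishing \<open>2 \<times> 2\<close> principal submatrix yields a nonzero vector orthogonal to the \<open>k\<close>-th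
  eigenvector on which the quadratic form is zero.
\<close>

lemma second_eigenvalue_nonneg:
  assumes uv: "u < n" "v < n" "u \<noteq> v"
    and zero: "A u u = 0" "A u v = 0" "A v u = 0" "A v v = 0"
    and le: "\<And>i. i < n \<Longrightarrow> i \<noteq> k \<Longrightarrow> d i \<le> M"
  shows "0 \<le> M"
proof -
  \<comment> \<open>\<open>x\<close> combines the basis vectors at \<open>u\<close> and
    \<open>v\<close> so as to be orthogonal to \<open>q k\<close>: the first alone if
    \<open>q k u = 0\<close>, otherwise with coefficients \<open>- q k v\<close> and
    \<open>q k u\<close>.\<close>
  define \<alpha> where "\<alpha> = (if q k u = 0 then 1 else - q k v)"
  define \<beta> where "\<beta> = (if q k u = 0 then 0 else q k u)"
  define x where "x a = (if a = u then \<alpha> else 0) + (if a = v then \<beta> else 0)" for a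
  have "(\<Sum>a<n. q k a * x a) = (\<Sum>a<n. (if a = u then q k u * \<alpha> else 0) + (if a = v then q k v * \<beta> else 0))"
    by (intro sum.cong) (auto simp: x_def algebra_simps)
  also have "\<dots> = 0"
    unfolding sum.distrib using uv by (simp add: \<alpha>_def \<beta>_def)
  finally have orth: "(\<Sum>a<n. q k a * x a) = 0" .
  have "0 = (\<Sum>a<n. \<Sum>b<n. A a b * x a * x b)"
    by (intro sum.neutral[symmetric] ballI sum.neutral) (use zero in \<open>auto simp: x_def\<close>)
  \<comment> \<open>The term \<open>i = k\<close> vanishes by \<open>orth\<close>; in every other
    term \<open>d i\<close> is at most \<open>M\<close>.\<close>
  also have "\<dots> \<le> (\<Sum>i<n. M * (\<Sum>a<n. q i a * x a)\<^sup>2)"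
    unfolding quadratic_form
  proof (rule sum_mono)
    fix i assume "i \<in> {..<n}"
    then show "d i * (\<Sum>a<n. q i a * x a)\<^sup>2 \<le> M * (\<Sum>a<n. q i a * x a)\<^sup>2"
      using le[of i] orth by (cases "i = k") (auto intro: mult_right_mono)
  qed
  also have "\<dots> = M * (\<Sum>a<n. (x a)\<^sup>2)"
    by (simp add: sum_distrib_left[symmetric] parseval)
  finally have "0 \<le> M * (\<Sum>a<n. (x a)\<^sup>2)" .
  moreover have "(\<Sum>a<n. (x a)\<^sup>2) > 0"
  proof (rule sum_pos2[of _ "if q k u = 0 then u else v"])
    show "0 < (x (if q k u = 0 then u else v))\<^sup>2"
      using uv by (auto simp: x_def \<alpha>_def \<beta>_def)
  qed (use uv in auto)
  ultimately show ?thesis by (simp add: zero_le_mult_iff)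
qed

end

text \<open>The columns of the diagonalizing matrix are the eigenvectors. Similarity gives
  \<open>A\<close> the characteristic polynomial of \<open>D\<close>, a product of linear factors,
  so \<open>d\<close> lists its roots with multiplicity.\<close>

lemma real_symmetric_spectral_decomposition:
  fixes A :: "real mat"
  assumes A: "A \<in> carrier_mat n n" and sym: "A\<^sup>T = A"
  shows "\<exists>d q. spectral_decomposition n (\<lambda>i j. A $$ (i, j)) d q \<and>
    proots (char_poly A) = image_mset d (mset_set {..<n})"
proof -
  obtain P D where P: "P \<in> carrier_mat n n" and D: "D \<in> carrier_mat n n"
    and PTP: "P\<^sup>T * P = 1\<^sub>m n" and PPT: "P * P\<^sup>T = 1\<^sub>m n" and diag: "diagonal_mat D"
    and A_eq: "A = P * D * P\<^sup>T"
    using real_symmetric_diagonalization[OF assms] by blast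
  define d where "d i = D $$ (i, i)" for i
  define q where "q i a = P $$ (a, i)" for i a
  have PD: "(P * D) $$ (a, i) = q i a * d i" if "a < n" "i < n" for a i
  proof -
    have "(P * D) $$ (a, i) = (\<Sum>j<n. P $$ (a, j) * D $$ (j, i))"
      using that P D by (simp add: scalar_prod_def atLeast0LessThan)
    also have "\<dots> = (\<Sum>j<n. if j = i then q i a * d i else 0)"
      using that diag D by (intro sum.cong) (auto simp: q_def d_def diagonal_mat_def)
    finally show ?thesis using that by simp
  qed
  have spectral: "spectral_decomposition n (\<lambda>i j. A $$ (i, j)) d q"
  proof
    fix i j assume ij: "i < n" "j < n"
    have "(P\<^sup>T * P) $$ (i, j) = (\<Sum>a<n. q i a * q j a)"
      using ij P by (simp add: scalar_prod_def atLeast0LessThan q_def)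
    then show "(\<Sum>a<n. q i a * q j a) = of_bool (i = j)"
      using ij by (auto simp: PTP)
    have "(P * P\<^sup>T) $$ (i, j) = (\<Sum>a<n. q a i * q a j)"
      using ij P by (simp add: scalar_prod_def atLeast0LessThan q_def)
    then show "(\<Sum>a<n. q a i * q a j) = of_bool (i = j)"
      using ij by (auto simp: PPT)
    have "A $$ (i, j) = (\<Sum>a<n. (P * D) $$ (i, a) * q a j)"
      unfolding A_eq using ij P D
      by (subst index_mult_mat) (auto simp: scalar_prod_def atLeast0LessThan q_def)
    then show "A $$ (i, j) = (\<Sum>a<n. d a * q a i * q a j)"
      using ij by (simp add: PD mult.commute)
  qed
  have "similar_mat A D"
    unfolding similar_mat_def similar_mat_wit_def Let_def
    using A P D PPT PTP A_eq by (intro exI[of _ P] exI[of _ "P\<^sup>T"]) auto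
  then have "char_poly A = char_poly D"
    by (rule char_poly_similar)
  also have "\<dots> = (\<Prod>a\<leftarrow>diag_mat D. [:- a, 1:])"
    using diag D by (intro char_poly_upper_triangular[OF D]) (auto simp: diagonal_mat_def)
  finally have "char_poly A = (\<Prod>a\<leftarrow>diag_mat D. [:- a, 1:])" .
  moreover have "proots (\<Prod>a\<leftarrow>diag_mat D. [:- a, 1:]) = mset (diag_mat D)"
  proof -
    \<comment> \<open>\<open>proots\<close> is additive on products of nonzero polynomials
      only.\<close>
    have "(\<Prod>a\<leftarrow>es. [:- a, 1:]) \<noteq> 0" for es :: "real list"
      by (induction es) (simp_all del: mult_pCons_left)
    then have "proots (\<Prod>a\<leftarrow>es. [:- a, 1:]) = mset es" for es :: "real list"
      by (induction es) (simp_all add: proots_mult del: mult_pCons_left)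
    then show ?thesis .
  qed
  moreover have "mset (diag_mat D) = image_mset d (mset_set {..<n})"
    using D by (simp add: diag_mat_def d_def[abs_def] atLeast0LessThan[symmetric])
  ultimately show ?thesis using spectral by metis
qed

section \<open>Triangles in diamond-free graphs\<close>

context pair_graph
begin

lemma arc_sym: "(u, v) \<in> parcs G \<Longrightarrow> (v, u) \<in> parcs G"
  using symD[OF pair_sym_arcs[unfolded symmetric_def]] by simp

lemma arc_neq: "(u, v) \<in> parcs G \<Longrightarrow> u \<noteq> v"
  using pair_no_loops by fastforce

lemma arc_in_verts: "(u, v) \<in> parcs G \<Longrightarrow> u \<in> pverts G \<and> v \<in> pverts G"
  using arc_fst_in_verts arc_snd_in_verts by fastforce

lemma edges_eq_image: "edges G = (\<lambda>(u, v). {u, v}) ` parcs G"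
  by (auto simp: edges_def)

lemma finite_edges: "finite (edges G)"
  unfolding edges_eq_image using pair_finite_arcs by simp

text \<open>Each edge comes from exactly two arcs, mutually inverse and distinct because there are
  no loops.\<close>

lemma sum_parcs_eq_sum_edges:
  fixes g :: "'a set \<Rightarrow> nat"
  shows "(\<Sum>(u, v)\<in>parcs G. g {u, v}) = 2 * (\<Sum>e\<in>edges G. g e)"
proof -
  have "(\<Sum>(u, v)\<in>parcs G. g {u, v})
      = (\<Sum>e\<in>edges G. \<Sum>(u, v)\<in>{a \<in> parcs G. (\<lambda>(u, v). {u, v}) a = e}. g {u, v})"
    unfolding edges_eq_image by (rule sum.image_gen[OF pair_finite_arcs])
  also have "\<dots> = (\<Sum>e\<in>edges G. 2 * g e)"
  proof (rule sum.cong)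
    fix e assume "e \<in> edges G"
    then obtain u v where uv: "(u, v) \<in> parcs G" "e = {u, v}" by (auto simp: edges_def)
    have "{a \<in> parcs G. (\<lambda>(u, v). {u, v}) a = e} = {(u, v), (v, u)}"
    proof (intro equalityI subsetI)
      fix a assume "a \<in> {a \<in> parcs G. (\<lambda>(u, v). {u, v}) a = e}"
      then show "a \<in> {(u, v), (v, u)}"
        by (cases a) (simp add: uv(2) doubleton_eq_iff)
    next
      fix a assume "a \<in> {(u, v), (v, u)}"
      then show "a \<in> {a \<in> parcs G. (\<lambda>(u, v). {u, v}) a = e}"
        using uv arc_sym[OF uv(1)] by (elim insertE) (simp_all add: insert_commute)
    qed
    then show "(\<Sum>(u, v)\<in>{a \<in> parcs G. (\<lambda>(u, v). {u, v}) a = e}. g {u, v}) = 2 * g e"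
      using arc_neq[OF uv(1)] by (simp add: uv(2) insert_commute[of v u])
  qed simp
  finally show ?thesis by (simp add: sum_distrib_left)
qed

lemma card_parcs: "card (parcs G) = 2 * card (edges G)"
  using sum_parcs_eq_sum_edges[of "\<lambda>_. 1"] by simp

lemma clique_finite: "clique G K \<Longrightarrow> finite K"
  using finite_subset[OF _ pair_finite_verts] by (simp add: clique_def)

text \<open>Two triangles on the arc \<open>(u, v)\<close> with different third vertices would form
  a diamond. Later arguments use diamond-freeness through this rule.\<close>

lemma diamond_freeD:
  assumes "diamond_free G"
    and arcs: "(u, v) \<in> parcs G" "(u, w) \<in> parcs G" "(v, w) \<in> parcs G"
      "(u, x) \<in> parcs G" "(v, x) \<in> parcs G"
  shows "w = x"
proof (rule ccontr)
  assume "w \<noteq> x"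
  then have distinct: "distinct [u, v, w, x]"
    using arcs arc_neq by auto
  define H where "H = \<lparr> pverts = {u, v, w, x},
    parcs = {(u, v), (v, u), (u, w), (w, u), (v, w), (w, v), (u, x), (x, u), (v, x), (x, v)} \<rparr>"
  \<comment> \<open>\<open>w\<close> and \<open>x\<close> must go to 2 and 3, the nonadjacent pair
    of \<open>diamond\<close>; \<open>x\<close> takes the default branch.\<close>
  define f :: "'a \<Rightarrow> nat" where
    "f y = (if y = u then 0 else if y = v then 1 else if y = w then 2 else 3)" for y
  define h where
    "h = \<lparr> iso_verts = f, iso_arcs = map_prod f f, iso_head = snd, iso_tail = fst \<rparr>"
  have wfH: "wf_digraph (with_proj H)"
    by unfold_locales (auto simp: H_def)
  have "subgraph (with_proj H) (with_proj G)"
    unfolding subgraph_def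
    using arcs arcs[THEN arc_sym] arcs[THEN arc_in_verts] wfH wf_digraph_axioms
    by (auto simp: H_def compatible_def)
  moreover have f: "f u = 0" "f v = 1" "f w = 2" "f x = 3"
    using distinct by (auto simp: f_def)
  have inj: "inj_on f {u, v, w, x}"
    using f by (auto simp: inj_on_def)
  have "digraph_iso (with_proj H) (with_proj diamond)"
    unfolding digraph_iso_def
  proof (intro exI conjI)
    have "inj_on (map_prod f f) (parcs H)"
      by (rule inj_on_subset[OF map_prod_inj_on[OF inj inj]]) (auto simp: H_def)
    then show "pre_digraph.digraph_isomorphism (with_proj H) h"
      unfolding pre_digraph.digraph_isomorphism_def using wfH inj by (auto simp: h_def H_def)
    have "parcs diamond = map_prod f f ` parcs H"
      by (auto simp: H_def diamond_def f)
    moreover have "pverts diamond = f ` pverts H"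
      by (auto simp: H_def diamond_def f)
    ultimately show "with_proj diamond = app_iso h (with_proj H)"
      by (simp add: app_iso_def with_proj_def h_def)
  qed
  ultimately show False using assms(1) by (auto simp: diamond_free_def)
qed

lemma cliqueD: "clique G K \<Longrightarrow> u \<in> K \<Longrightarrow> v \<in> K \<Longrightarrow> u \<noteq> v \<Longrightarrow> (u, v) \<in> parcs G"
  by (simp add: clique_def)

text \<open>Any four vertices of a clique span two triangles on a common edge.\<close>

lemma diamond_free_card_clique_le:
  assumes "diamond_free G" "clique G K"
  shows "card K \<le> 3"
proof (rule ccontr)
  assume "\<not> card K \<le> 3"
  then obtain S where "S \<subseteq> K" "card S = 4"
    using obtain_subset_with_card_n[of 4 K] by auto
  then obtain u v w x where "S = {u, v, w, x}" "distinct [u, v, w, x]"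
    by (auto simp: card_Suc_eq numeral_eq_Suc)
  with \<open>S \<subseteq> K\<close> have "w = x"
    by (intro diamond_freeD[OF assms(1), of u v]) (auto intro!: cliqueD[OF assms(2)])
  with \<open>distinct [u, v, w, x]\<close> show False by simp
qed

section \<open>Counting triangles by their edges\<close>

definition triangles :: "'a set set" where
  "triangles = {T. clique G T \<and> card T = 3}"

lemma triangle_third_vertex:
  assumes "T \<in> triangles" "u \<in> T" "v \<in> T" "u \<noteq> v"
  obtains w where "T = {u, v, w}" "(u, w) \<in> parcs G" "(v, w) \<in> parcs G"
proof -
  have "finite T" "card T = 3" using assms clique_finite by (auto simp: triangles_def)
  then have "card (T - {u, v}) = 1" using assms by (simp add: card_Diff_subset)
  then obtain w where w: "T - {u, v} = {w}" by (auto simp: card_1_singleton_iff)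
  then have "T = {u, v, w}" "w \<noteq> u" "w \<noteq> v" "w \<in> T" using assms by auto
  then show ?thesis using that cliqueD assms by (auto simp: triangles_def)
qed

lemma triangleI:
  assumes "(u, v) \<in> parcs G" "(v, w) \<in> parcs G" "(w, u) \<in> parcs G"
  shows "{u, v, w} \<in> triangles"
  using assms arc_sym arc_in_verts arc_neq[OF assms(1)] arc_neq[OF assms(2)] arc_neq[OF assms(3)]
  by (auto simp: triangles_def clique_def)

definition triangle_edges :: "'a set set" where
  "triangle_edges = {e \<in> edges G. \<exists>T\<in>triangles. e \<subseteq> T}"

lemma diamond_free_triangle_unique:
  assumes "diamond_free G" "T \<in> triangles" "T' \<in> triangles" "{u, v} \<subseteq> T" "{u, v} \<subseteq> T'" "u \<noteq> v"
  shows "T = T'"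
proof -
  obtain w where w: "T = {u, v, w}" "(u, w) \<in> parcs G" "(v, w) \<in> parcs G"
    using triangle_third_vertex[of T u v] assms by auto
  obtain x where x: "T' = {u, v, x}" "(u, x) \<in> parcs G" "(v, x) \<in> parcs G"
    using triangle_third_vertex[of T' u v] assms by auto
  have "(u, v) \<in> parcs G" using assms cliqueD by (auto simp: triangles_def)
  then show ?thesis using diamond_freeD[OF assms(1) _ w(2,3) x(2,3)] w x by simp
qed

lemma finite_triangles: "finite triangles"
  by (rule finite_subset[of _ "Pow (pverts G)"])
    (auto simp: triangles_def clique_def pair_finite_verts)

text \<open>Every triangle contributes its three pairs of vertices, and distinct triangles share no
  edge.\<close>

lemma card_triangle_edges:
  assumes "diamond_free G"
  shows "card triangle_edges = 3 * num_triangles G"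
proof -
  have fin: "finite T" if "T \<in> triangles" for T
    using that clique_finite by (auto simp: triangles_def)
  have "triangle_edges = (\<Union>T\<in>triangles. {e. e \<subseteq> T \<and> card e = 2})" (is "_ = ?U")
  proof (intro equalityI subsetI)
    fix e assume "e \<in> triangle_edges"
    then show "e \<in> ?U"
      by (auto simp: triangle_edges_def edges_def arc_neq)
  next
    fix e assume "e \<in> ?U"
    then obtain T where T: "T \<in> triangles" "e \<subseteq> T" "card e = 2" by auto
    then obtain u v where uv: "e = {u, v}" "u \<noteq> v" by (auto simp: card_2_iff)
    then have "(u, v) \<in> parcs G" using T cliqueD by (auto simp: triangles_def)
    then show "e \<in> triangle_edges"
      using T uv by (auto simp: triangle_edges_def edges_def)
  qed
  also have "card \<dots> = (\<Sum>T\<in>triangles. card {e. e \<subseteq> T \<and> card e = 2})"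
  proof (rule card_UN_disjoint)
    show "\<forall>T\<in>triangles. \<forall>T'\<in>triangles. T \<noteq> T' \<longrightarrow>
        {e. e \<subseteq> T \<and> card e = 2} \<inter> {e. e \<subseteq> T' \<and> card e = 2} = {}"
    proof (intro ballI impI equals0I)
      fix T T' e
      assume TT: "T \<in> triangles" "T' \<in> triangles" "T \<noteq> T'"
        and e: "e \<in> {e. e \<subseteq> T \<and> card e = 2} \<inter> {e. e \<subseteq> T' \<and> card e = 2}"
      from e obtain u v where "e = {u, v}" "u \<noteq> v" by (auto simp: card_2_iff)
      with TT e diamond_free_triangle_unique[OF assms, of T T' u v] show False by auto
    qed
  qed (auto simp: finite_triangles intro: finite_subset[OF _ finite_Pow_iff[THEN iffD2, OF fin]])
  also have "\<dots> = (\<Sum>T\<in>triangles. 3)"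
    by (rule sum.cong) (auto simp: n_subsets[OF fin] triangles_def numeral_eq_Suc)
  finally show ?thesis by (simp add: num_triangles_def triangles_def)
qed

lemma card_triangle_edges_le: "card triangle_edges \<le> card (edges G)"
  by (rule card_mono[OF finite_edges]) (auto simp: triangle_edges_def)

text \<open>The edge itself is a clique of order 2, no clique exceeds order 3, and a clique of order
  3 is a triangle.\<close>

lemma diamond_free_edge_clique_number:
  assumes "diamond_free G" "e \<in> edges G"
  shows "edge_clique_number G e = (if e \<in> triangle_edges then 3 else 2)"
proof -
  obtain u v where uv: "(u, v) \<in> parcs G" "e = {u, v}" using assms by (auto simp: edges_def)
  have e: "clique G e" "card e = 2"
    using uv arc_sym arc_in_verts arc_neq[OF uv(1)] by (auto simp: clique_def)
  let ?S = "{card K | K. clique G K \<and> e \<subseteq> K}"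
  have le3: "k \<le> 3" if "k \<in> ?S" for k
    using that diamond_free_card_clique_le[OF assms(1)] by auto
  have fin: "finite ?S"
    by (rule finite_subset[of _ "{..3}"]) (use le3 in auto)
  have "Max ?S = 3" if "e \<in> triangle_edges"
    using that le3 fin by (intro Max_eqI) (auto simp: triangle_edges_def triangles_def)
  moreover have "Max ?S = 2" if "e \<notin> triangle_edges"
  proof (rule Max_eqI[OF fin])
    fix k assume "k \<in> ?S"
    then obtain K where K: "k = card K" "clique G K" "e \<subseteq> K" by auto
    then have "card K \<noteq> 3"
      using that assms(2) by (auto simp: triangle_edges_def triangles_def)
    then show "k \<le> 2" using le3[OF \<open>k \<in> ?S\<close>] K by simp
  qed (use e in auto)
  ultimately show ?thesis by (simp add: edge_clique_number_def)
qed

text \<open>The summand is 1 off the triangles and \<open>4/3\<close> on a triangle edge; the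
  \<open>3 t\<close> surpluses of \<open>1/3\<close> add up to \<open>t\<close>.\<close>

lemma diamond_free_sum_edge_clique_number:
  assumes "diamond_free G"
  shows "(\<Sum>e\<in>edges G. 2 * (1 - 1 / real (edge_clique_number G e)))
    = real (card (edges G)) + real (num_triangles G)"
proof -
  have "(\<Sum>e\<in>edges G. 2 * (1 - 1 / real (edge_clique_number G e)))
      = (\<Sum>e\<in>edges G. 1 + (if e \<in> triangle_edges then 1 / 3 else 0))"
    by (rule sum.cong) (auto simp: diamond_free_edge_clique_number[OF assms])
  also have "\<dots> = real (card (edges G)) + real (card triangle_edges) / 3"
  proof -
    have "edges G \<inter> triangle_edges = triangle_edges" by (auto simp: triangle_edges_def)
    then show ?thesis by (simp add: sum.distrib sum.If_cases finite_edges)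
  qed
  finally show ?thesis by (simp add: card_triangle_edges[OF assms])
qed

text \<open>A common neighbour of adjacent \<open>u\<close> and \<open>v\<close> closes a triangle,
  and diamond-freeness allows at most one.\<close>

lemma diamond_free_card_common_neighbours:
  assumes "diamond_free G" "(u, v) \<in> parcs G"
  shows "card {w. (v, w) \<in> parcs G \<and> (w, u) \<in> parcs G} = of_bool ({u, v} \<in> triangle_edges)"
proof (cases "\<exists>w. (v, w) \<in> parcs G \<and> (w, u) \<in> parcs G")
  case True
  then obtain w where w: "(v, w) \<in> parcs G" "(w, u) \<in> parcs G" by blast
  then have "{w. (v, w) \<in> parcs G \<and> (w, u) \<in> parcs G} = {w}"
    using diamond_freeD[OF assms] arc_sym by blast
  moreover have "{u, v} \<in> triangle_edges"
    using triangleI[OF assms(2) w] assms(2) by (auto simp: triangle_edges_def edges_def)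
  ultimately show ?thesis by simp
next
  case False
  have "{u, v} \<notin> triangle_edges"
  proof
    assume "{u, v} \<in> triangle_edges"
    then obtain T where "T \<in> triangles" "u \<in> T" "v \<in> T" by (auto simp: triangle_edges_def)
    then obtain w where "(u, w) \<in> parcs G" "(v, w) \<in> parcs G"
      using arc_neq[OF assms(2)] by (rule triangle_third_vertex)
    then show False using False arc_sym by blast
  qed
  moreover have "{w. (v, w) \<in> parcs G \<and> (w, u) \<in> parcs G} = {}" using False by auto
  ultimately show ?thesis by (simp only: card.empty of_bool_eq)
qed

text \<open>Each of the \<open>3 t\<close> triangle edges gives two arcs, each with exactly one
  common neighbour of its ends.\<close>

lemma diamond_free_card_closed_walks3:
  assumes "diamond_free G"
  shows "(\<Sum>(u, v)\<in>parcs G. card {w. (v, w) \<in> parcs G \<and> (w, u) \<in> parcs G})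
    = 6 * num_triangles G"
proof -
  have "(\<Sum>(u, v)\<in>parcs G. card {w. (v, w) \<in> parcs G \<and> (w, u) \<in> parcs G})
      = (\<Sum>(u, v)\<in>parcs G. of_bool ({u, v} \<in> triangle_edges))"
    by (rule sum.cong) (auto simp: diamond_free_card_common_neighbours[OF assms])
  also have "\<dots> = 2 * (\<Sum>e\<in>edges G. of_bool (e \<in> triangle_edges))"
    by (rule sum_parcs_eq_sum_edges)
  also have "(\<Sum>e\<in>edges G. of_bool (e \<in> triangle_edges)) = card triangle_edges"
  proof -
    have "edges G \<inter> triangle_edges = triangle_edges" by (auto simp: triangle_edges_def)
    then show ?thesis by (simp add: of_bool_def sum.If_cases finite_edges)
  qed
  finally show ?thesis by (simp add: card_triangle_edges[OF assms])
qed

end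

section \<open>The adjacency matrix\<close>

lemma (in pair_graph) sum_of_bool_arcs:
  fixes g :: "'a \<Rightarrow> 'a \<Rightarrow> real"
  shows "(\<Sum>u\<in>pverts G. \<Sum>v\<in>pverts G. of_bool ((u, v) \<in> parcs G) * g u v)
    = (\<Sum>(u, v)\<in>parcs G. g u v)"
  unfolding sum.cartesian_product
  by (rule sum.mono_neutral_cong_right) (auto simp: pair_finite_verts dest: arc_in_verts)

context pair_graph
begin

abbreviation "vs \<equiv> vertex_list G"
abbreviation "n \<equiv> length (vertex_list G)"

lemma vertex_list: "distinct vs" "set vs = pverts G"
proof -
  have "\<exists>xs. distinct xs \<and> set xs = pverts G"
    using finite_distinct_list[OF pair_finite_verts] by blast
  from someI_ex[OF this] show "distinct vs" "set vs = pverts G"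
    by (auto simp: vertex_list_def)
qed

lemma sum_vertex_list: "(\<Sum>i<n. f (vs ! i)) = (\<Sum>v\<in>pverts G. f v)"
  using sum.reindex_bij_betw[OF bij_betw_nth[OF vertex_list(1) refl vertex_list(2)[symmetric]]] .

lemma adjacency_matrix_carrier: "adjacency_matrix G \<in> carrier_mat n n"
  by (simp add: adjacency_matrix_def Let_def)

lemma adjacency_matrix_entry:
  "i < n \<Longrightarrow> j < n \<Longrightarrow> adjacency_matrix G $$ (i, j) = of_bool ((vs ! i, vs ! j) \<in> parcs G)"
  by (simp add: adjacency_matrix_def Let_def)

lemma adjacency_matrix_symmetric: "(adjacency_matrix G)\<^sup>T = adjacency_matrix G"
  by (rule eq_matI)
    (use adjacency_matrix_carrier arc_sym in \<open>auto simp: adjacency_matrix_entry\<close>)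

text \<open>The product of opposite entries is 1 exactly at the arcs, two per edge.\<close>

lemma adjacency_trace_square:
  "(\<Sum>i<n. \<Sum>j<n. adjacency_matrix G $$ (i, j) * adjacency_matrix G $$ (j, i))
    = 2 * real (card (edges G))"
proof -
  have "(\<Sum>i<n. \<Sum>j<n. adjacency_matrix G $$ (i, j) * adjacency_matrix G $$ (j, i))
      = (\<Sum>i<n. \<Sum>j<n. of_bool ((vs ! i, vs ! j) \<in> parcs G) * of_bool ((vs ! j, vs ! i) \<in> parcs G))"
    by (intro sum.cong) (auto simp: adjacency_matrix_entry)
  also have "\<dots> = (\<Sum>u\<in>pverts G. \<Sum>v\<in>pverts G.
      of_bool ((u, v) \<in> parcs G) * of_bool ((v, u) \<in> parcs G))"
    by (simp only: sum_vertex_list[symmetric])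
  also have "\<dots> = (\<Sum>(u, v)\<in>parcs G. of_bool ((v, u) \<in> parcs G))"
    by (rule sum_of_bool_arcs)
  also have "\<dots> = (\<Sum>(u, v)\<in>parcs G. 1)"
    by (rule sum.cong) (use arc_sym in auto)
  finally show ?thesis by (simp add: card_parcs)
qed

lemma adjacency_trace_cube:
  assumes "diamond_free G"
  shows "(\<Sum>i<n. \<Sum>j<n. \<Sum>k<n. adjacency_matrix G $$ (i, j) * adjacency_matrix G $$ (j, k) *
      adjacency_matrix G $$ (k, i)) = 6 * real (num_triangles G)"
proof -
  have "(\<Sum>i<n. \<Sum>j<n. \<Sum>k<n. adjacency_matrix G $$ (i, j) * adjacency_matrix G $$ (j, k) *
      adjacency_matrix G $$ (k, i))
    = (\<Sum>i<n. \<Sum>j<n. of_bool ((vs ! i, vs ! j) \<in> parcs G) *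
      (\<Sum>k<n. of_bool ((vs ! j, vs ! k) \<in> parcs G \<and> (vs ! k, vs ! i) \<in> parcs G)))"
    unfolding sum_distrib_left by (intro sum.cong) (auto simp: adjacency_matrix_entry)
  also have "\<dots> = (\<Sum>u\<in>pverts G. \<Sum>v\<in>pverts G. of_bool ((u, v) \<in> parcs G) *
      (\<Sum>w\<in>pverts G. of_bool ((v, w) \<in> parcs G \<and> (w, u) \<in> parcs G)))"
    by (simp only: sum_vertex_list[symmetric])
  also have "\<dots> = (\<Sum>(u, v)\<in>parcs G. \<Sum>w\<in>pverts G. of_bool ((v, w) \<in> parcs G \<and> (w, u) \<in> parcs G))"
    by (rule sum_of_bool_arcs)
  also have "\<dots> = real (\<Sum>(u, v)\<in>parcs G. card {w. (v, w) \<in> parcs G \<and> (w, u) \<in> parcs G})"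
    unfolding of_nat_sum
  proof (rule sum.cong[OF refl], clarify)
    fix u v
    have "pverts G \<inter> {w. (v, w) \<in> parcs G \<and> (w, u) \<in> parcs G}
        = {w. (v, w) \<in> parcs G \<and> (w, u) \<in> parcs G}"
      using arc_in_verts by blast
    then show "(\<Sum>w\<in>pverts G. of_bool ((v, w) \<in> parcs G \<and> (w, u) \<in> parcs G))
        = real (card {w. (v, w) \<in> parcs G \<and> (w, u) \<in> parcs G})"
      using pair_finite_verts by (simp add: of_bool_def sum.If_cases)
  qed
  finally show ?thesis by (simp add: diamond_free_card_closed_walks3[OF assms])
qed

end

section \<open>Nonadjacent vertices and the eigenvalue bound\<close>

lemma (in pair_graph) not_complete_nonadjacent:
  assumes "\<nexists>k. complete_digraph k (with_proj G)"
  obtains u v where "u \<in> pverts G" "v \<in> pverts G" "u \<noteq> v" "(u, v) \<notin> parcs G"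
proof -
  have "parcs G \<noteq> {(u, v). (u, v) \<in> pverts G \<times> pverts G \<and> u \<noteq> v}"
    using assms pair_graphD_graph by (auto simp: complete_digraph_def)
  moreover have "parcs G \<subseteq> {(u, v). (u, v) \<in> pverts G \<times> pverts G \<and> u \<noteq> v}"
    using arc_in_verts arc_neq by auto
  ultimately show ?thesis using that by blast
qed

text \<open>Turns removal of one value from the eigenvalue multiset into removal of one index, so
  that the second eigenvalue bounds all \<open>d i\<close> but one.\<close>

lemma image_mset_remove_index:
  fixes n :: nat
  assumes "image_mset d (mset_set {..<n}) = add_mset x M"
  shows "\<exists>k<n. \<forall>i<n. i \<noteq> k \<longrightarrow> d i \<in># M"
proof -
  have "x \<in># image_mset d (mset_set {..<n})" by (simp add: assms)
  then obtain k where k: "k < n" "x = d k" by auto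
  then have "mset_set {..<n} = add_mset k (mset_set ({..<n} - {k}))"
    by (intro mset_set.remove) auto
  with assms k have "image_mset d (mset_set ({..<n} - {k})) = M" by simp
  then have "d i \<in># M" if "i < n" "i \<noteq> k" for i
    using that by auto
  with k show ?thesis by blast
qed

theorem theorem4p4:
  fixes G :: "'a pair_pre_digraph"
  assumes "pair_graph G"
    and "Digraph_Component.connected (with_proj G)"
    and "diamond_free G"
    and "\<nexists>n. complete_digraph n (with_proj G)"
    and "num_triangles G \<notin> {1, 2, 3, 4}"
  shows "(adjacency_eigenvalue 1 G)\<^sup>2 + (adjacency_eigenvalue 2 G)\<^sup>2
    \<le> (\<Sum>e\<in>edges G. 2 * (1 - 1 / real (edge_clique_number G e)))"
proof (rule ccontr)
  interpret pair_graph G by fact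
  define m where "m = real (card (edges G))"
  define t where "t = real (num_triangles G)"
  define A where "A = adjacency_matrix G"
  define \<Lambda> where "\<Lambda> = adjacency_eigenvalues G"
  obtain d q where "spectral_decomposition n (\<lambda>i j. A $$ (i, j)) d q"
    and roots: "proots (char_poly A) = image_mset d (mset_set {..<n})"
    using real_symmetric_spectral_decomposition[OF adjacency_matrix_carrier adjacency_matrix_symmetric]
    unfolding A_def by blast
  then interpret S: spectral_decomposition n "\<lambda>i j. A $$ (i, j)" d q by simp
  have mset_\<Lambda>: "mset \<Lambda> = image_mset d (mset_set {..<n})" and sorted: "sorted (rev \<Lambda>)"
    by (simp_all add: \<Lambda>_def adjacency_eigenvalues_def A_def[symmetric] roots)
  have sum_\<Lambda>: "(\<Sum>i<n. f (d i)) = (\<Sum>x\<leftarrow>\<Lambda>. f x)" for f :: "real \<Rightarrow> real"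
  proof -
    have "(\<Sum>x\<leftarrow>\<Lambda>. f x) = sum_mset (image_mset f (mset \<Lambda>))"
      by (metis mset_map sum_mset_sum_list)
    then show ?thesis by (simp add: mset_\<Lambda> sum_unfold_sum_mset multiset.map_comp comp_def)
  qed
  \<comment> \<open>The nonadjacent pair serves twice: it shows that at least two eigenvalues exist,
    and it provides the zero principal submatrix for \<open>0 \<le> l2\<close>.\<close>
  obtain a b where ab: "a < n" "b < n" "a \<noteq> b" "(vs ! a, vs ! b) \<notin> parcs G"
    using not_complete_nonadjacent[OF assms(4)] vertex_list(2) by (metis in_set_conv_nth)
  have "length \<Lambda> = n"
    using arg_cong[OF mset_\<Lambda>, of size] by simp
  then obtain l1 l2 rest where \<Lambda>: "\<Lambda> = l1 # l2 # rest"
    using ab by (metis (no_types) Suc_less_eq less_nat_zero_code list.exhaust list.size(3,4) less_Suc0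
        plus_1_eq_Suc add.commute length_0_conv length_Cons)
  have order: "l2 \<le> l1" "\<And>x. x \<in> set rest \<Longrightarrow> x \<le> l2"
    using sorted by (auto simp: \<Lambda> sorted_append)
  have d_mem: "d i \<in> set \<Lambda>" if "i < n" for i
    using that mset_\<Lambda> by (metis finite_lessThan finite_set_mset_mset_set image_eqI lessThan_iff
        set_image_mset set_mset_mset)
  have mem_d: "\<exists>i<n. x = d i" if "x \<in> set \<Lambda>" for x
    using that arg_cong[OF mset_\<Lambda>, of set_mset] by auto
  have d_le: "d i \<le> l1" if "i < n" for i
    using d_mem[OF that] order by (force simp: \<Lambda>)
  \<comment> \<open>The adjacency matrix is entrywise nonnegative, so its largest eigenvalue is its
    spectral radius.\<close>
  have abs_le: "\<bar>x\<bar> \<le> l1" if "x \<in> set \<Lambda>" for x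
    using mem_d[OF that] S.nonneg_abs_eigenvalue_le[OF _ d_le]
    by (auto simp: A_def adjacency_matrix_entry)
  obtain k where k: "\<forall>i<n. i \<noteq> k \<longrightarrow> d i \<in># mset (l2 # rest)"
    using image_mset_remove_index[of d n l1 "mset (l2 # rest)"] mset_\<Lambda> by (auto simp: \<Lambda>)
  have "0 \<le> l2"
  proof (rule S.second_eigenvalue_nonneg[OF ab(1-3), of k])
    show "d i \<le> l2" if "i < n" "i \<noteq> k" for i
      using k that order by force
  qed (use ab arc_neq arc_sym in \<open>auto simp: A_def adjacency_matrix_entry\<close>)
  have squares: "l1\<^sup>2 + l2\<^sup>2 + (\<Sum>x\<leftarrow>rest. x\<^sup>2) = 2 * m"
    using S.trace_square adjacency_trace_square sum_\<Lambda>[of "\<lambda>x. x\<^sup>2"]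
    by (simp add: A_def m_def \<Lambda>)
  have cubes: "l1 ^ 3 + l2 ^ 3 + (\<Sum>x\<leftarrow>rest. x ^ 3) = 6 * t"
    using S.trace_cube adjacency_trace_cube[OF assms(3)] sum_\<Lambda>[of "\<lambda>x. x ^ 3"]
    by (simp add: A_def t_def \<Lambda>)
  have "3 * t \<le> m"
    using card_triangle_edges_le card_triangle_edges[OF assms(3)] by (simp add: t_def m_def)
  have "0 \<le> t" by (simp add: t_def)
  assume "\<not> ?thesis"
  then have violated: "m + t < l1\<^sup>2 + l2\<^sup>2"
    unfolding diamond_free_sum_edge_clique_number[OF assms(3)]
    by (simp add: adjacency_eigenvalue_def \<Lambda>_def[symmetric] \<Lambda> m_def t_def)
  have "l2\<^sup>2 \<le> l1\<^sup>2"
    using order \<open>0 \<le> l2\<close> by (intro power_mono) auto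
  \<comment> \<open>\<open>4 t \<le> m + t < l1^2 + l2^2 \<le> 2 l1^2\<close>, so
    \<open>sqrt (2 * t)\<close> lies in the range allowed for the entries of
    \<open>zs\<close>.\<close>
  with violated \<open>3 * t \<le> m\<close> \<open>0 \<le> t\<close> have "2 * t \<le> l1\<^sup>2" "0 < l1\<^sup>2" by linarith+
  then have "0 < l1" using order \<open>0 \<le> l2\<close> by (cases "l1 = 0") auto
  \<comment> \<open>With the extra entry the squares sum to \<open>2 (m + t) - l1^2 - l2^2\<close>,
    which the violated bound makes less than \<open>l1^2 + l2^2\<close>.\<close>
  define zs where "zs = sqrt (2 * t) # map abs rest"
  have "(\<Sum>z\<leftarrow>zs. z ^ 3) < l1 ^ 3 + l2 ^ 3"
  proof (rule sum_list_cubes_less)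
    show "0 \<le> z \<and> z \<le> l1" if "z \<in> set zs" for z
      using that abs_le \<open>2 * t \<le> l1\<^sup>2\<close> \<open>0 < l1\<close> \<open>0 \<le> t\<close>
      by (auto simp: zs_def \<Lambda> intro: real_le_lsqrt)
    show "(\<Sum>z\<leftarrow>zs. z\<^sup>2) < l1\<^sup>2 + l2\<^sup>2"
      using squares violated \<open>0 \<le> t\<close> by (simp add: zs_def comp_def)
  qed (use order \<open>0 \<le> l2\<close> \<open>0 < l1\<close> in auto)
  \<comment> \<open>Passing to absolute values costs nothing: the cubes in \<open>rest\<close> sum
    to at least minus the sum of their absolute values, so \<open>l1^3 + l2^3\<close> is at most
    \<open>6 t\<close> plus the latter sum.\<close>
  moreover have "0 \<le> (\<Sum>x\<leftarrow>rest. x ^ 3 + \<bar>x\<bar> ^ 3)"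
    by (intro sum_list_nonneg) (auto simp: power_abs[symmetric])
  ultimately have "sqrt (2 * t) ^ 3 < 6 * t"
    using cubes by (simp add: zs_def comp_def sum_list_addf)
  moreover have "sqrt (2 * t) ^ 3 = 2 * t * sqrt (2 * t)"
    using \<open>0 \<le> t\<close> by (simp add: power3_eq_cube)
  \<comment> \<open>For \<open>t = 0\<close> the strict inequality reads \<open>0 < 0\<close>; for
    \<open>t \<ge> 5\<close>, \<open>sqrt (2 * t)\<close> is at least 3, which contradicts
    \<open>2 * t * sqrt (2 * t) < 6 * t\<close>.\<close>
  moreover have "t = 0 \<or> 5 \<le> t"
    using assms(5) by (auto simp: t_def)
  moreover have "3 \<le> sqrt (2 * t)" if "5 \<le> t"
    using that by (intro real_le_rsqrt) auto
  ultimately show False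
    using mult_left_mono[of 3 "sqrt (2 * t)" "2 * t"] \<open>0 \<le> t\<close> by auto
qed

end
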